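(* Let $\eta\in(0,1)$, $r>0$ with $\eta e^{2r}<1$. For $t\le0$ let $m_t$, as a function of the angle sequence $\theta=(\theta_s)_{s\le0}$, be the first component of the bounded solution of the recursion in the context, with Fourier expansion $m_t=\sum_n c_{t,n}\prod_s e^{in_s\theta_s}$ over finitely supported integer patterns $n:\mathbb Z_{\le0}\to\mathbb Z$. Every pattern $n$ occurring in this expansion ($c_{t,n}\ne0$) obeys: (selection) $q(n):=\sum_s n_s=+1$; (ordering) at the latest slot $t^*$ with $n_{t^*}\ne0$ one has $n_{t^*}\in\{+1,+2\}$; (per-slot) $|n_s|\le2$ for every slot $s$.
   Context: $v_t=(m_t,\bar m_t,J_t)^\top$, $t\le 0$, is the unique bounded solution of $v_t=T(\theta_t)v_{t-1}+b_{\rm vac}$, with $b_{\rm vac}=(0,0,\tfrac{1-\eta}{2})^\top$ and $$T(\theta)=\eta\begin{pmatrix}\cosh^2 r& e^{2i\theta}\sinh^2 r&-e^{i\theta}\sinh 2r\\ e^{-2i\theta}\sinh^2 r&\cosh^2 r&-e^{-i\theta}\sinh2r\\ -\tfrac12e^{-i\theta}\sinh2r&-\tfrac12e^{i\theta}\sinh2r&\cosh2r\end{pmatrix}.$$ Since every row of $|T(\theta)|$ (entrywise) sums to $\eta e^{2r}<1$, unrolling $v_t=b_{\rm vac}+\sum_{k\ge1}T(\theta_t)\cdots T(\theta_{t-k+1})b_{\rm vac}$ and expanding each entry in exponentials gives an absolutely convergent Fourier series on the torus of angle sequences; its coefficients are the $c_{t,n}$. In the paper's model $\theta_s=\varphi_s+\beta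 s_s$ (mask phase plus encoded input), so $\prod_s e^{in_s\theta_s}$ equals the constant $e^{i\sum_s n_s\varphi_s}$ times the input character $E_n=\prod_s e^{i\beta n_s s_s}$. *)

theory Defs
  imports "HOL-Analysis.Analysis"
begin

text \<open>
  Times and slots are integers; only those \<open>\<le> 0\<close> matter. An angle sequence is a function
  \<open>\<theta> :: int \<Rightarrow> real\<close> of which only the restriction to \<open>{..0}\<close> is ever used.
\<close>

definition transfer :: "real \<Rightarrow> real \<Rightarrow> real \<Rightarrow> complex ^ 3 ^ 3" where
  "transfer \<eta> r \<theta> = \<eta> *\<^sub>R vector
     [vector [of_real ((cosh r)\<^sup>2), cis (2 * \<theta>) * of_real ((sinh r)\<^sup>2), - cis \<theta> * of_real (sinh (2 * r))],
      vector [cis (- 2 * \<theta>) * of_real ((sinh r)\<^sup>2), of_real ((cosh r)\<^sup>2), - cis (- \<theta>) * of_real (sinh (2 * r))],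
      vector [- (1 / 2) * cis (- \<theta>) * of_real (sinh (2 * r)), - (1 / 2) * cis \<theta> * of_real (sinh (2 * r)),
              of_real (cosh (2 * r))]]"

definition b_vac :: "real \<Rightarrow> complex ^ 3" where
  "b_vac \<eta> = vector [0, 0, of_real ((1 - \<eta>) / 2)]"

definition bounded_solution :: "real \<Rightarrow> real \<Rightarrow> (int \<Rightarrow> real) \<Rightarrow> (int \<Rightarrow> complex ^ 3) \<Rightarrow> bool" where
  "bounded_solution \<eta> r \<theta> v \<longleftrightarrow>
     bounded (v ` {..0}) \<and> (\<forall>t\<le>0. v t = transfer \<eta> r (\<theta> t) *v v (t - 1) + b_vac \<eta>)"

text \<open>The constraint \<open>extensional\<close> only pins down the irrelevant values at times \<open>t > 0\<close>.\<close>

definition state :: "real \<Rightarrow> real \<Rightarrow> (int \<Rightarrow> real) \<Rightarrow> int \<Rightarrow> complex ^ 3" where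
  "state \<eta> r \<theta> = (THE v. v \<in> extensional {..0} \<and> bounded_solution \<eta> r \<theta> v)"

definition moment :: "real \<Rightarrow> real \<Rightarrow> int \<Rightarrow> (int \<Rightarrow> real) \<Rightarrow> complex" where
  "moment \<eta> r t \<theta> = state \<eta> r \<theta> t $ 1"

definition support :: "(int \<Rightarrow> int) \<Rightarrow> int set" where
  "support n = {s. n s \<noteq> 0}"

definition patterns :: "(int \<Rightarrow> int) set" where
  "patterns = {n. finite (support n) \<and> support n \<subseteq> {..0}}"

definition character :: "(int \<Rightarrow> int) \<Rightarrow> (int \<Rightarrow> real) \<Rightarrow> complex" where
  "character n \<theta> = (\<Prod>s\<in>support n. cis (of_int (n s) * \<theta> s))"

definition fourier_expansion :: "((int \<Rightarrow> real) \<Rightarrow> complex) \<Rightarrow> ((int \<Rightarrow> int) \<Rightarrow> complex) \<Rightarrow> bool" where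
  "fourier_expansion f c \<longleftrightarrow>
     (\<lambda>n. norm (c n)) summable_on patterns \<and>
     (\<forall>\<theta>. ((\<lambda>n. c n * character n \<theta>) has_sum f \<theta>) patterns)"

text \<open>
  The coefficients of an absolutely convergent Fourier series are unique on \<open>patterns\<close>;
  again \<open>extensional\<close> only pins down the values elsewhere.
\<close>

definition fourier_coeff :: "((int \<Rightarrow> real) \<Rightarrow> complex) \<Rightarrow> (int \<Rightarrow> int) \<Rightarrow> complex" where
  "fourier_coeff f = (THE c. c \<in> extensional patterns \<and> fourier_expansion f c)"

definition charge :: "(int \<Rightarrow> int) \<Rightarrow> int" where
  "charge n = (\<Sum>s\<in>support n. n s)"

end

(*
  Conjugating by diag(e^{i\<theta>}, e^{-i\<theta>}, 1) shows that the angle dependence of T(\<theta>) is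
  T(\<theta>)_ij = T(0)_ij e^{i (q_i - q_j) \<theta>} with charges q = (1, -1, 0). Unrolling the recursion along
  index paths i = j_0, j_1, ..., j_k therefore attaches to each path a single pattern, with value
  q_{j_l} - q_{j_(l+1)} in slot t - l, and only paths ending in the third component contribute.
  The total charge telescopes to q_i = 1, and a path started in the first component stays there,
  with pattern value 0, until its first step to another component contributes 2 or 1.
  The sum over all paths is a bounded solution, hence the state; collecting the paths with the
  same pattern gives the Fourier expansion, whose coefficients are unique.
*)
theory Submission
  imports Defs
begin

section \<open>Characters\<close>

lemma character_superset:
  assumes "finite A" "support n \<subseteq> A"
  shows "character n \<theta> = (\<Prod>s\<in>A. cis (of_int (n s) * \<theta> s))"
  unfolding character_def
  by (rule prod.mono_neutral_left) (use assms in \<open>auto simp: support_def\<close>)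

lemma charge_superset:
  assumes "finite A" "support n \<subseteq> A"
  shows "charge n = (\<Sum>s\<in>A. n s)"
  unfolding charge_def
  by (rule sum.mono_neutral_left) (use assms in \<open>auto simp: support_def\<close>)

lemma norm_character [simp]: "norm (character n \<theta>) = 1"
  by (simp add: character_def prod_norm[symmetric])

lemma character_nonzero [simp]: "character n \<theta> \<noteq> 0"
  using norm_character[of n \<theta>] by (metis norm_zero zero_neq_one)

lemma character_add: "character n (\<lambda>s. \<theta> s + \<theta>' s) = character n \<theta> * character n \<theta>'"
  by (simp add: character_def prod.distrib[symmetric] cis_mult algebra_simps)

lemma character_zero_angle [simp]: "character n (\<lambda>_. 0) = 1"
  by (simp add: character_def)

lemma character_zero_pattern [simp]: "character (\<lambda>_. 0) \<theta> = 1"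
  by (simp add: character_def support_def)

text \<open>An angle sequence concentrated on one slot probes a single pattern value; this is what
  tells two characters apart.\<close>

lemma character_single_angle:
  assumes "finite (support n)"
  shows "character n (\<lambda>s. if s = s0 then x else 0) = cis (of_int (n s0) * x)"
proof -
  have "character n (\<lambda>s. if s = s0 then x else 0) =
      (\<Prod>s\<in>insert s0 (support n). if s = s0 then cis (of_int (n s0) * x) else 1)"
    by (subst character_superset[OF finite.insertI[OF assms] subset_insertI])
       (rule prod.cong, auto)
  also have "\<dots> = cis (of_int (n s0) * x)"
    using assms by (subst prod.delta) auto
  finally show ?thesis .
qed

lemma support_fun_upd_subset: "support (n(s := a)) \<subseteq> insert s (support n)"
  by (auto simp: support_def)

lemma character_fun_upd:
  assumes "finite (support n)" "n s = 0"
  shows "character (n(s := a)) \<theta> = cis (of_int a * \<theta> s) * character n \<theta>"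
proof -
  have s: "s \<notin> support n"
    using assms by (simp add: support_def)
  \<comment> \<open>For \<open>a = 0\<close> the slot \<open>s\<close> stays outside the new
    support, so the product is taken over \<open>insert s (support n)\<close> in either
    case.\<close>
  have "character (n(s := a)) \<theta> =
      (\<Prod>s'\<in>insert s (support n). cis (of_int ((n(s := a)) s') * \<theta> s'))"
    using assms by (intro character_superset support_fun_upd_subset) auto
  also have "\<dots> = cis (of_int a * \<theta> s) * character n \<theta>"
    using assms s unfolding character_def by (auto intro!: prod.cong)
  finally show ?thesis .
qed

lemma charge_fun_upd:
  assumes "finite (support n)" "n s = 0"
  shows "charge (n(s := a)) = a + charge n"
proof -
  have s: "s \<notin> support n"
    using assms by (simp add: support_def)
  have "charge (n(s := a)) = (\<Sum>s'\<in>insert s (support n). (n(s := a)) s')"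
    using assms by (intro charge_superset support_fun_upd_subset) auto
  also have "\<dots> = a + charge n"
    using assms s unfolding charge_def by (auto intro!: sum.cong)
  finally show ?thesis .
qed

section \<open>Uniqueness of Fourier coefficients\<close>

text \<open>
  Averaging a vanishing series over \<open>\<theta>\<close> and \<open>\<theta> + h\<close>, after division by the \<open>m\<close>-th character,
  keeps the \<open>m\<close>-th coefficient, and it removes the \<open>k\<close>-th one if the \<open>k\<close>-th and the \<open>m\<close>-th
  character have opposite signs at \<open>h\<close>.
\<close>

lemma fourier_expansion_zero_annihilate:
  assumes "fourier_expansion (\<lambda>_. 0) d" "finite F" "F \<subseteq> patterns" "m \<in> patterns" "m \<notin> F"
  shows "\<exists>d'. fourier_expansion (\<lambda>_. 0) d' \<and> (\<forall>n. norm (d' n) \<le> norm (d n)) \<and>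
              d' m = d m \<and> (\<forall>k\<in>F. d' k = 0)"
  using assms(2,3,5)
proof (induction F rule: finite_induct)
  case empty
  show ?case using assms(1) by (intro exI[of _ d]) auto
next
  case (insert k F)
  then obtain d' where d': "fourier_expansion (\<lambda>_. 0) d'" "\<And>n. norm (d' n) \<le> norm (d n)"
      "d' m = d m" "\<And>k. k \<in> F \<Longrightarrow> d' k = 0"
    by auto
  from insert.prems obtain s where s: "k s \<noteq> m s"
    by (metis ext insertI1)
  \<comment> \<open>The angle is chosen so that \<open>(k s - m s) * h s = pi\<close>; the two
    characters then differ at \<open>h\<close> by the factor \<open>cis pi\<close>, which is
    -1.\<close>
  define h where "h = (\<lambda>s'. if s' = s then pi / of_int (k s - m s) else 0 :: real)"
  define e where "e n = d' n * ((1 + character n h / character m h) / 2)" for n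
  have fin: "finite (support k)" "finite (support m)"
    using insert.prems assms(4) by (auto simp: patterns_def)
  have "of_int (k s) * (pi / of_int (k s - m s)) = of_int (m s) * (pi / of_int (k s - m s)) + pi"
    using s by (simp add: field_simps)
  then have "character k h = character m h * cis pi"
    using fin by (simp only: h_def character_single_angle cis_mult)
  then have ek: "e k = 0"
    by (simp add: e_def)
  have factor: "norm ((1 + character n h / character m h) / 2) \<le> 1" for n
    using norm_triangle_ineq[of 1 "character n h / character m h"]
    by (simp add: norm_divide)
  have le: "norm (e n) \<le> norm (d' n)" for n
    unfolding e_def norm_mult by (intro mult_left_le factor norm_ge_zero)
  have "fourier_expansion (\<lambda>_. 0) e"
    unfolding fourier_expansion_def
  proof (intro conjI allI)
    have "(\<lambda>n. norm (d' n)) summable_on patterns"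
      using d'(1) by (simp add: fourier_expansion_def)
    then show "(\<lambda>n. norm (e n)) summable_on patterns"
      using le by (rule Infinite_Sum.abs_summable_on_comparison_test)
    fix \<theta> :: "int \<Rightarrow> real"
    have hs: "((\<lambda>n. d' n * character n \<theta>') has_sum 0) patterns" for \<theta>'
      using d'(1) by (simp add: fourier_expansion_def)
    have "((\<lambda>n. (1/2) * (d' n * character n \<theta>)
              + (1 / (2 * character m h)) * (d' n * character n (\<lambda>s. \<theta> s + h s)))
            has_sum ((1/2) * 0 + (1 / (2 * character m h)) * 0)) patterns"
      by (intro has_sum_add has_sum_cmult_right hs)
    also have "(\<lambda>n. (1/2) * (d' n * character n \<theta>)
              + (1 / (2 * character m h)) * (d' n * character n (\<lambda>s. \<theta> s + h s)))
            = (\<lambda>n. e n * character n \<theta>)"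
      by (auto simp: e_def character_add field_simps)
    finally show "((\<lambda>n. e n * character n \<theta>) has_sum 0) patterns"
      by simp
  qed
  moreover have "norm (e n) \<le> norm (d n)" for n
    using le[of n] d'(2)[of n] by linarith
  moreover have "e m = d m"
    by (simp add: e_def d'(3))
  moreover have "e k' = 0" if "k' \<in> insert k F" for k'
    using that ek d'(4) by (auto simp: e_def)
  ultimately show ?case by blast
qed

text \<open>If \<open>d m\<close> were nonzero, some finite set of patterns would carry the total
  norm up to an error of \<open>norm (d m) / 2\<close>. Annihilating that set apart from
  \<open>m\<close> leaves a vanishing series in which \<open>d m\<close> would have to be cancelled
  by a tail of norm at most \<open>norm (d m) / 2\<close>.\<close>

lemma fourier_expansion_zero_unique:
  assumes "fourier_expansion (\<lambda>_. 0) d" "m \<in> patterns"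
  shows "d m = 0"
proof (rule ccontr)
  assume "d m \<noteq> 0"
  have sd: "(\<lambda>n. norm (d n)) summable_on patterns"
    using assms(1) by (simp add: fourier_expansion_def)
  obtain F where F: "finite F" "F \<subseteq> patterns"
      "dist (\<Sum>n\<in>F. norm (d n)) (\<Sum>\<^sub>\<infinity>n\<in>patterns. norm (d n)) \<le> norm (d m) / 2"
    using infsum_finite_approximation[OF sd, of "norm (d m) / 2"] \<open>d m \<noteq> 0\<close> by auto
  define G where "G = F - {m}"
  have G: "finite G" "G \<subseteq> patterns" "m \<notin> G"
    using F by (auto simp: G_def)
  obtain d' where d': "fourier_expansion (\<lambda>_. 0) d'" "\<And>n. norm (d' n) \<le> norm (d n)"
      "d' m = d m" "\<And>k. k \<in> G \<Longrightarrow> d' k = 0"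
    using fourier_expansion_zero_annihilate[OF assms(1) G(1,2) assms(2) G(3)] by blast
  define R where "R = patterns - insert m G"
  have fin: "finite (insert m G)" and sub: "insert m G \<subseteq> patterns"
    using G assms(2) by auto
  have "((\<lambda>n. d' n * character n (\<lambda>_. 0)) has_sum 0) patterns"
    using d'(1) by (simp only: fourier_expansion_def)
  then have "(d' has_sum 0) patterns"
    by simp
  then have "(d' has_sum (0 - sum d' (insert m G))) R"
    unfolding R_def using fin sub by (intro has_sum_Diff has_sum_finite) auto
  moreover have "sum d' (insert m G) = d m"
    using G d'(3,4) by simp
  ultimately have d'_R: "(d' has_sum (- d m)) R"
    by simp
  have d_R: "((\<lambda>n. norm (d n)) has_sum
      ((\<Sum>\<^sub>\<infinity>n\<in>patterns. norm (d n)) - (\<Sum>n\<in>insert m G. norm (d n)))) R"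
    unfolding R_def using fin sub sd by (intro has_sum_Diff has_sum_finite has_sum_infsum) auto
  have "(\<lambda>n. norm (d' n)) summable_on R"
    by (rule Infinite_Sum.abs_summable_on_comparison_test[OF has_sum_imp_summable[OF d_R]]) (rule d'(2))
  then have d'_R_norm: "((\<lambda>n. norm (d' n)) has_sum (\<Sum>\<^sub>\<infinity>n\<in>R. norm (d' n))) R"
    by (rule has_sum_infsum)
  have "norm (- d m) \<le> (\<Sum>\<^sub>\<infinity>n\<in>R. norm (d' n))"
    by (rule norm_has_sum_bound[OF d'_R_norm d'_R])
  also have "\<dots> \<le> (\<Sum>\<^sub>\<infinity>n\<in>patterns. norm (d n)) - (\<Sum>n\<in>insert m G. norm (d n))"
    by (rule has_sum_mono[OF d'_R_norm d_R d'(2)])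
  finally have "norm (- d m) \<le> (\<Sum>\<^sub>\<infinity>n\<in>patterns. norm (d n)) - (\<Sum>n\<in>insert m G. norm (d n))" .
  moreover have "(\<Sum>n\<in>F. norm (d n)) \<le> (\<Sum>n\<in>insert m G. norm (d n))"
    using fin by (intro sum_mono2) (auto simp: G_def)
  ultimately have "norm (d m) \<le> norm (d m) / 2"
    using F(3) unfolding dist_real_def norm_minus_cancel by linarith
  then show False
    using \<open>d m \<noteq> 0\<close> by simp
qed

text \<open>Two expansions of the same \<open>f\<close> differ by an expansion of 0, whose
  coefficients vanish on \<open>patterns\<close>; hence any expansion at hand determines the
  definite description.\<close>

lemma fourier_coeff_eqI:
  assumes "fourier_expansion f c" "n \<in> patterns"
  shows "fourier_coeff f n = c n"
proof -
  have cong: "fourier_expansion f (restrict c patterns)"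
    using assms(1) unfolding fourier_expansion_def
    by (simp cong: summable_on_cong has_sum_cong)
  have "fourier_coeff f = restrict c patterns"
    unfolding fourier_coeff_def
  proof (rule the_equality)
    show "restrict c patterns \<in> extensional patterns \<and> fourier_expansion f (restrict c patterns)"
      using cong by simp
  next
    fix c' assume c': "c' \<in> extensional patterns \<and> fourier_expansion f c'"
    have "fourier_expansion (\<lambda>_. 0) (\<lambda>n. c' n - c n)"
      unfolding fourier_expansion_def
    proof (intro conjI allI)
      have "(\<lambda>n. norm (c' n) + norm (c n)) summable_on patterns"
        using c' assms(1) by (auto simp: fourier_expansion_def intro!: summable_on_add)
      then show "(\<lambda>n. norm (c' n - c n)) summable_on patterns"
        by (rule summable_on_comparison_test) (auto simp: norm_triangle_ineq4)
      fix \<theta> :: "int \<Rightarrow> real"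
      have "((\<lambda>n. c' n * character n \<theta> + - (c n * character n \<theta>)) has_sum (f \<theta> + - f \<theta>)) patterns"
        using c' assms(1)
        by (intro has_sum_add has_sum_uminus[THEN iffD2]) (auto simp: fourier_expansion_def)
      then show "((\<lambda>n. (c' n - c n) * character n \<theta>) has_sum 0) patterns"
        by (simp add: algebra_simps)
    qed
    then have "c' m - c m = 0" if "m \<in> patterns" for m
      using fourier_expansion_zero_unique that by fastforce
    then show "c' = restrict c patterns"
      using c' by (auto simp: extensional_def restrict_def)
  qed
  then show ?thesis
    using assms(2) by simp
qed

text \<open>Absolute convergence permits summing first over each fibre of \<open>p\<close>, where
  the character is constant, and then over patterns.\<close>

lemma fourier_expansion_group:
  fixes w :: "'a \<Rightarrow> complex"
  assumes w: "(\<lambda>x. norm (w x)) summable_on UNIV"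
    and p: "\<And>x. p x \<in> patterns"
    and f: "\<And>\<theta>. f \<theta> = (\<Sum>\<^sub>\<infinity>x. w x * character (p x) \<theta>)"
  shows "fourier_expansion f (\<lambda>n. \<Sum>\<^sub>\<infinity>x\<in>p -` {n}. w x)"
proof -
  \<comment> \<open>Each \<open>x\<close> is paired with its own pattern, so \<open>snd\<close> maps
    \<open>D\<close> bijectively onto \<open>UNIV\<close> and sums over \<open>x\<close> become sums
    over a disjoint union of fibres.\<close>
  define D where "D = (SIGMA n:patterns. p -` {n})"
  have inj: "inj_on snd D"
    by (auto simp: D_def inj_on_def)
  have img: "snd ` D = UNIV"
    using p by (force simp: D_def)
  have "(\<lambda>y. norm (w (snd y))) summable_on D"
    using w summable_on_reindex[OF inj, of "\<lambda>x. norm (w x)"] by (simp add: img o_def)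
  then have 1: "(\<lambda>n. norm (\<Sum>\<^sub>\<infinity>x\<in>p -` {n}. norm (w x))) summable_on patterns"
    using Infinite_Sum.abs_summable_on_Sigma_iff[where f = "\<lambda>y. w (snd y)" and A = patterns and B = "\<lambda>n. p -` {n}"]
    by (simp add: D_def)
  have sub: "(\<lambda>x. norm (w x)) summable_on p -` {n}" for n
    using w by (rule summable_on_subset_banach) auto
  have summ: "(\<lambda>n. norm (\<Sum>\<^sub>\<infinity>x\<in>p -` {n}. w x)) summable_on patterns"
    using 1 by (rule Infinite_Sum.abs_summable_on_comparison_test)
      (use norm_infsum_bound[OF sub] in \<open>auto intro: order_trans[OF _ abs_ge_self]\<close>)
  have "((\<lambda>n. (\<Sum>\<^sub>\<infinity>x\<in>p -` {n}. w x) * character n \<theta>) has_sum f \<theta>) patterns" for \<theta>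
  proof -
    have "(\<lambda>x. norm (w x * character (p x) \<theta>)) summable_on UNIV"
      using w by (simp add: norm_mult)
    then have "((\<lambda>x. w x * character (p x) \<theta>) has_sum f \<theta>) (snd ` D)"
      unfolding f img by (rule has_sum_infsum[OF abs_summable_summable])
    then have "((\<lambda>y. w (snd y) * character (p (snd y)) \<theta>) has_sum f \<theta>) D"
      unfolding has_sum_reindex[OF inj] o_def .
    moreover have "((\<lambda>x. w (snd (n, x)) * character (p (snd (n, x))) \<theta>) has_sum
        ((\<Sum>\<^sub>\<infinity>x\<in>p -` {n}. w x) * character n \<theta>)) (p -` {n})" for n
    proof -
      have "((\<lambda>x. w x * character n \<theta>) has_sum ((\<Sum>\<^sub>\<infinity>x\<in>p -` {n}. w x) * character n \<theta>)) (p -` {n})"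
        by (rule has_sum_cmult_left[OF has_sum_infsum[OF abs_summable_summable[OF sub]]])
      then show ?thesis
        by (rule has_sum_cong[THEN iffD1, rotated]) simp
    qed
    ultimately show ?thesis
      unfolding D_def by (rule has_sum_SigmaD)
  qed
  with summ show ?thesis
    by (simp add: fourier_expansion_def)
qed

section \<open>The transfer matrix\<close>

text \<open>The weights of the three components under a common shift of all angles: 1 for the
  moment, -1 for its conjugate partner, 0 for the third.\<close>

definition component_charge :: "3 \<Rightarrow> int" where
  "component_charge i = (if i = 1 then 1 else if i = 2 then - 1 else 0)"

lemma transfer_nth:
  "transfer \<eta> r \<theta> $ i $ j =
     cis (of_int (component_charge i - component_charge j) * \<theta>) * transfer \<eta> r 0 $ i $ j"
  using exhaust_3[of i] exhaust_3[of j]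
  by (elim disjE) (simp_all add: transfer_def component_charge_def)

text \<open>Phases have modulus 1. Apart from the factor \<eta>, the first two rows give
  \<open>(cosh r)^2 + (sinh r)^2 + sinh (2 * r)\<close> and the third gives
  \<open>cosh (2 * r)\<close> plus two halves of \<open>sinh (2 * r)\<close>; both are
  \<open>exp (2 * r)\<close>.\<close>

lemma sum_norm_transfer_row:
  assumes "\<eta> \<ge> 0" "r \<ge> 0"
  shows "(\<Sum>j\<in>UNIV. norm (transfer \<eta> r \<theta> $ i $ j)) = \<eta> * exp (2 * r)"
proof -
  have "exp (2 * r) = (cosh r)\<^sup>2 + (sinh r)\<^sup>2 + sinh (2 * r)"
    by (simp add: cosh_double sinh_double cosh_plus_sinh[symmetric])
  then show ?thesis
    using assms exhaust_3[of i]
    by (elim disjE)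
       (simp_all add: sum_3 transfer_def norm_mult norm_power,
        simp_all add: cosh_double distrib_left add_ac)
qed

section \<open>Uniqueness of the bounded solution\<close>

lemma bounded_solution_step:
  "bounded_solution \<eta> r \<theta> v \<Longrightarrow> t \<le> 0 \<Longrightarrow> v t = transfer \<eta> r (\<theta> t) *v v (t - 1) + b_vac \<eta>"
  unfolding bounded_solution_def by blast

text \<open>The difference of two solutions satisfies the homogeneous recursion. Looking back
  \<open>k\<close> steps bounds each component by \<open>\<rho> ^ k\<close> times a uniform cap on
  the earlier differences, which tends to 0.\<close>

lemma bounded_solution_unique:
  assumes "0 \<le> \<eta>" "0 \<le> r" "\<eta> * exp (2 * r) < 1"
    and u: "bounded_solution \<eta> r \<theta> u" and v: "bounded_solution \<eta> r \<theta> v" and "t \<le> 0"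
  shows "u t = v t"
proof -
  define \<rho> where "\<rho> = \<eta> * exp (2 * r)"
  have \<rho>: "0 \<le> \<rho>" "\<rho> < 1"
    using assms by (auto simp: \<rho>_def)
  obtain A where A: "\<And>s. s \<le> 0 \<Longrightarrow> norm (u s) \<le> A"
    using u unfolding bounded_solution_def bounded_iff by blast
  obtain B where B: "\<And>s. s \<le> 0 \<Longrightarrow> norm (v s) \<le> B"
    using v unfolding bounded_solution_def bounded_iff by blast
  have bound: "norm ((u s - v s) $ i) \<le> \<rho> ^ k * (A + B)" if "s \<le> 0" for s i k
    using that
  proof (induction k arbitrary: s i)
    case 0
    have "norm ((u s - v s) $ i) \<le> norm (u s - v s)"
      by (rule Finite_Cartesian_Product.norm_nth_le)
    also have "\<dots> \<le> A + B"
      using A[OF 0] B[OF 0] norm_triangle_ineq4[of "u s" "v s"] by linarith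
    finally show ?case by simp
  next
    case (Suc k)
    have "u s - v s = transfer \<eta> r (\<theta> s) *v (u (s - 1) - v (s - 1))"
      using bounded_solution_step[OF u Suc.prems] bounded_solution_step[OF v Suc.prems]
      by (simp add: matrix_vector_mult_diff_distrib)
    then have "norm ((u s - v s) $ i) \<le>
        (\<Sum>j\<in>UNIV. norm (transfer \<eta> r (\<theta> s) $ i $ j * (u (s - 1) - v (s - 1)) $ j))"
      by (simp add: matrix_vector_mult_def norm_sum del: vector_minus_component)
    also have "\<dots> \<le> (\<Sum>j\<in>UNIV. norm (transfer \<eta> r (\<theta> s) $ i $ j) * (\<rho> ^ k * (A + B)))"
      unfolding norm_mult using Suc.prems by (intro sum_mono mult_left_mono Suc.IH) auto
    also have "\<dots> = \<rho> ^ Suc k * (A + B)"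
      using sum_norm_transfer_row[of \<eta> r "\<theta> s" i] assms
      by (simp add: sum_distrib_right[symmetric] \<rho>_def)
    finally show ?case .
  qed
  have "(\<lambda>k. \<rho> ^ k * (A + B)) \<longlonglongrightarrow> 0 * (A + B)"
    using \<rho> by (intro tendsto_mult LIMSEQ_realpow_zero tendsto_const)
  then have "norm ((u t - v t) $ i) \<le> 0 * (A + B)" for i
    by (rule LIMSEQ_le_const) (use bound[OF \<open>t \<le> 0\<close>] in blast)
  then show ?thesis
    by (simp add: vec_eq_iff)
qed

lemma state_eqI:
  assumes "0 \<le> \<eta>" "0 \<le> r" "\<eta> * exp (2 * r) < 1" "bounded_solution \<eta> r \<theta> v" "t \<le> 0"
  shows "state \<eta> r \<theta> t = v t"
proof -
  have eq: "restrict v {..0} ` {..0} = v ` {..0}"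
    by force
  have sol: "bounded_solution \<eta> r \<theta> (restrict v {..0})"
    unfolding bounded_solution_def eq
  proof (intro conjI allI impI)
    show "bounded (v ` {..0})"
      using assms(4) unfolding bounded_solution_def by blast
    fix s :: int
    assume s: "s \<le> 0"
    \<comment> \<open>\<open>s - 1\<close> is again at most 0, so the recursion never reads a value
      that the restriction discards.\<close>
    then show "restrict v {..0} s = transfer \<eta> r (\<theta> s) *v restrict v {..0} (s - 1) + b_vac \<eta>"
      using bounded_solution_step[OF assms(4) s] by simp
  qed
  have "state \<eta> r \<theta> = restrict v {..0}"
    unfolding state_def
  proof (rule the_equality)
    show "restrict v {..0} \<in> extensional {..0} \<and> bounded_solution \<eta> r \<theta> (restrict v {..0})"
      using sol by simp
  next
    fix v' assume v': "v' \<in> extensional {..0} \<and> bounded_solution \<eta> r \<theta> v'"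
    then have "v' t = v t" if "t \<le> 0" for t
      using bounded_solution_unique[OF assms(1-3) _ assms(4) that] by blast
    then show "v' = restrict v {..0}"
      using v' by (auto simp: extensional_def restrict_def)
  qed
  then show ?thesis
    using assms(5) by simp
qed

section \<open>Expansion over index paths\<close>

text \<open>Weights use \<open>transfer\<close> at angle 0; all phases go into the pattern. The list
  holds the components visited after \<open>i\<close>, and the empty list stands for stopping at
  \<open>i\<close> with the source term.\<close>

primrec path_weight :: "real \<Rightarrow> real \<Rightarrow> 3 \<Rightarrow> 3 list \<Rightarrow> complex" where
  "path_weight \<eta> r i [] = b_vac \<eta> $ i"
| "path_weight \<eta> r i (j # js) = transfer \<eta> r 0 $ i $ j * path_weight \<eta> r j js"

text \<open>Each step moves to the slot below, so the update at \<open>t\<close> meets a slot that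
  is still 0, and no slot is written twice.\<close>

primrec path_pattern :: "int \<Rightarrow> 3 \<Rightarrow> 3 list \<Rightarrow> int \<Rightarrow> int" where
  "path_pattern t i [] = (\<lambda>_. 0)"
| "path_pattern t i (j # js) =
     (path_pattern (t - 1) j js)(t := component_charge i - component_charge j)"

text \<open>The unrolled recursion: lists of length \<open>k\<close> account for the product of
  \<open>k\<close> transfer matrices applied to \<open>b_vac \<eta>\<close>.\<close>

definition path_sum :: "real \<Rightarrow> real \<Rightarrow> (int \<Rightarrow> real) \<Rightarrow> int \<Rightarrow> 3 \<Rightarrow> complex" where
  "path_sum \<eta> r \<theta> t i =
     (\<Sum>\<^sub>\<infinity>js. path_weight \<eta> r i js * character (path_pattern t i js) \<theta>)"

lemma b_vac_nth: "b_vac \<eta> $ i = (if i = 3 then of_real ((1 - \<eta>) / 2) else 0)"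
  using exhaust_3[of i] by (auto simp: b_vac_def)

lemma path_pattern_after: "s > t \<Longrightarrow> path_pattern t i js s = 0"
  by (induction js arbitrary: t i) auto

lemma support_path_pattern: "support (path_pattern t i js) \<subseteq> {..t}"
proof
  fix s
  assume "s \<in> support (path_pattern t i js)"
  then show "s \<in> {..t}"
    using path_pattern_after[of t s i js] by (cases "t < s") (auto simp: support_def)
qed

lemma finite_support_path_pattern: "finite (support (path_pattern t i js))"
proof (induction js arbitrary: t i)
  case (Cons j js)
  then show ?case
    using finite_subset[OF support_fun_upd_subset] by (metis finite.insertI path_pattern.simps(2))
qed (simp add: support_def)

lemma path_pattern_in_patterns: "t \<le> 0 \<Longrightarrow> path_pattern t i js \<in> patterns"
  using support_path_pattern[of t i js] finite_support_path_pattern[of t i js]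
  by (auto simp: patterns_def)

lemma character_path_pattern_Cons:
  "character (path_pattern t i (j # js)) \<theta> =
     cis (of_int (component_charge i - component_charge j) * \<theta> t) *
     character (path_pattern (t - 1) j js) \<theta>"
  by (simp add: character_fun_upd finite_support_path_pattern path_pattern_after)

section \<open>Absolute convergence and recursion of the path sum\<close>

lemma lists_UNIV_Cons: "UNIV = insert [] (range (\<lambda>(j, js). j # js))"
proof (intro set_eqI)
  fix js :: "'a list"
  show "js \<in> UNIV \<longleftrightarrow> js \<in> insert [] (range (\<lambda>(j, js). j # js))"
    by (cases js) auto
qed

text \<open>Splitting off the first step bounds the sum for \<open>Suc N\<close> by
  \<open>?a\<close>, which bounds the source term, plus the row sum \<open>?\<rho>\<close> times the
  bound for \<open>N\<close>. The claimed bound is the fixed point of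
  \<open>x \<mapsto> ?a + ?\<rho> * x\<close>, so it persists.\<close>

lemma sum_norm_path_weight_le:
  assumes "0 < \<eta>" "\<eta> < 1" "r > 0" "\<eta> * exp (2 * r) < 1"
  shows "(\<Sum>js | length js \<le> N. norm (path_weight \<eta> r i js)) \<le> (1 - \<eta>) / 2 / (1 - \<eta> * exp (2 * r))"
    (is "_ \<le> ?a / (1 - ?\<rho>)")
proof (induction N arbitrary: i)
  have b: "norm (b_vac \<eta> $ i) \<le> ?a" for i
    using assms by (auto simp: b_vac_nth simp del: of_real_diff of_real_divide)
  {
    case 0
    have "norm (b_vac \<eta> $ i) \<le> ?a"
      by (rule b)
    also have "?a \<le> ?a / (1 - ?\<rho>)"
      using assms by (simp add: field_simps)
    finally show ?case
      by simp
  next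
    case (Suc N)
    have geometric: "x + y * (x / (1 - y)) = x / (1 - y)" if "y \<noteq> 1" for x y :: real
      using that by (simp add: field_simps)
    let ?L = "{js :: 3 list. length js \<le> N}"
    have fin: "finite ?L"
      using finite_lists_length_le[of "UNIV :: 3 set" N] by simp
    have inj: "inj_on (\<lambda>(j, js). j # js) (UNIV \<times> ?L)"
      by (auto simp: inj_on_def)
    have lists_Suc: "{js :: 3 list. length js \<le> Suc N} = insert [] ((\<lambda>(j, js). j # js) ` (UNIV \<times> ?L))"
      (is "_ = insert _ ?C")
    proof (intro set_eqI)
      fix js :: "3 list"
      show "js \<in> {js. length js \<le> Suc N} \<longleftrightarrow> js \<in> insert [] ?C"
        by (cases js) auto
    qed
    have "(\<Sum>js | length js \<le> Suc N. norm (path_weight \<eta> r i js)) =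
        norm (b_vac \<eta> $ i) + (\<Sum>js\<in>?C. norm (path_weight \<eta> r i js))"
      unfolding lists_Suc using fin by (subst sum.insert) auto
    also have "(\<Sum>js\<in>?C. norm (path_weight \<eta> r i js)) =
        (\<Sum>(j, js)\<in>UNIV \<times> ?L. norm (transfer \<eta> r 0 $ i $ j) * norm (path_weight \<eta> r j js))"
      by (subst sum.reindex[OF inj]) (simp add: norm_mult case_prod_unfold o_def)
    also have "\<dots> =
        (\<Sum>j\<in>UNIV. norm (transfer \<eta> r 0 $ i $ j) * (\<Sum>js\<in>?L. norm (path_weight \<eta> r j js)))"
      by (simp add: sum.cartesian_product[symmetric] sum_distrib_left)
    also have "\<dots> \<le> (\<Sum>j\<in>UNIV. norm (transfer \<eta> r 0 $ i $ j) * (?a / (1 - ?\<rho>)))"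
      by (intro sum_mono mult_left_mono Suc.IH) auto
    also have "\<dots> = ?\<rho> * (?a / (1 - ?\<rho>))"
      using sum_norm_transfer_row[of \<eta> r 0 i] assms unfolding sum_distrib_right[symmetric] by simp
    finally have "(\<Sum>js | length js \<le> Suc N. norm (path_weight \<eta> r i js)) \<le> ?a + ?\<rho> * (?a / (1 - ?\<rho>))"
      using b[of i] by linarith
    also have "\<dots> = ?a / (1 - ?\<rho>)"
      by (rule geometric) (use assms(4) in simp)
    finally show ?case .
  }
qed

text \<open>Finitely many lists have bounded length, so the bound uniform in the length covers every
  finite partial sum.\<close>

lemma path_weight_abs_summable:
  assumes "0 < \<eta>" "\<eta> < 1" "r > 0" "\<eta> * exp (2 * r) < 1"
  shows "(\<lambda>js. norm (path_weight \<eta> r i js)) summable_on UNIV"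
proof (rule nonneg_bdd_above_summable_on)
  have "(\<Sum>js\<in>F. norm (path_weight \<eta> r i js)) \<le> (1 - \<eta>) / 2 / (1 - \<eta> * exp (2 * r))"
    if "finite F" for F
  proof -
    have "F \<subseteq> {js. length js \<le> Max (length ` F)}"
      using that by auto
    moreover have "finite {js :: 3 list. length js \<le> Max (length ` F)}"
      using finite_lists_length_le[of "UNIV :: 3 set"] by simp
    ultimately have "(\<Sum>js\<in>F. norm (path_weight \<eta> r i js)) \<le>
        (\<Sum>js | length js \<le> Max (length ` F). norm (path_weight \<eta> r i js))"
      by (intro sum_mono2) auto
    then show ?thesis
      using sum_norm_path_weight_le[OF assms] by (rule order_trans)
  qed
  then show "bdd_above (sum (\<lambda>js. norm (path_weight \<eta> r i js)) ` {F. F \<subseteq> UNIV \<and> finite F})"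
    by (intro bdd_aboveI) auto
qed auto

text \<open>The empty path yields the source term; the remaining paths are sorted by their first
  step.\<close>

lemma path_sum_recursion:
  assumes "0 < \<eta>" "\<eta> < 1" "r > 0" "\<eta> * exp (2 * r) < 1"
  shows "path_sum \<eta> r \<theta> t i =
    (\<Sum>j\<in>UNIV. transfer \<eta> r (\<theta> t) $ i $ j * path_sum \<eta> r \<theta> (t - 1) j) + b_vac \<eta> $ i"
proof -
  define g where "g js = path_weight \<eta> r i js * character (path_pattern t i js) \<theta>" for js
  define C where "C = (\<lambda>(j :: 3, js). j # js)"
  have inj: "inj C"
    by (auto simp: C_def inj_on_def)
  have "(\<lambda>js. norm (g js)) summable_on UNIV"
    using path_weight_abs_summable[OF assms] by (simp add: g_def norm_mult)
  then have g: "g summable_on UNIV"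
    by (rule abs_summable_summable)
  then have gC: "(g \<circ> C) summable_on UNIV"
    using summable_on_subset_banach summable_on_reindex[OF inj] by blast
  have "path_sum \<eta> r \<theta> t i = infsum g (insert [] (range C))"
    unfolding path_sum_def C_def g_def[abs_def] lists_UNIV_Cons[symmetric] ..
  also have "\<dots> = g [] + infsum g (range C)"
    using g summable_on_subset_banach by (intro infsum_insert) (auto simp: C_def)
  also have "infsum g (range C) = infsum (g \<circ> C) (UNIV \<times> UNIV)"
    by (simp add: infsum_reindex[OF inj])
  also have "\<dots> = (\<Sum>\<^sub>\<infinity>j. \<Sum>\<^sub>\<infinity>js. (g \<circ> C) (j, js))"
    using gC by (intro infsum_Sigma_banach[symmetric]) simp
  also have "\<dots> = (\<Sum>j\<in>UNIV. \<Sum>\<^sub>\<infinity>js. (g \<circ> C) (j, js))"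
    by simp
  also have "\<dots> = (\<Sum>j\<in>UNIV. transfer \<eta> r (\<theta> t) $ i $ j * path_sum \<eta> r \<theta> (t - 1) j)"
  proof (rule sum.cong)
    fix j :: 3
    \<comment> \<open>The phase written in slot \<open>t\<close> recombines with the entry at angle
      0 to the entry at \<open>\<theta> t\<close>.\<close>
    have "(g \<circ> C) (j, js) = transfer \<eta> r (\<theta> t) $ i $ j *
        (path_weight \<eta> r j js * character (path_pattern (t - 1) j js) \<theta>)" for js
      unfolding g_def C_def transfer_nth[of _ _ "\<theta> t"]
      by (simp add: character_path_pattern_Cons del: path_pattern.simps)
    then show "(\<Sum>\<^sub>\<infinity>js. (g \<circ> C) (j, js)) = transfer \<eta> r (\<theta> t) $ i $ j * path_sum \<eta> r \<theta> (t - 1) j"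
      unfolding path_sum_def by (simp add: infsum_cmult_right')
  qed simp
  finally show ?thesis
    by (simp add: g_def)
qed

text \<open>Characters have modulus 1, so the total path weight bounds each component uniformly in
  time.\<close>

lemma bounded_solution_path_sum:
  assumes "0 < \<eta>" "\<eta> < 1" "r > 0" "\<eta> * exp (2 * r) < 1"
  shows "bounded_solution \<eta> r \<theta> (\<lambda>t. \<chi> i. path_sum \<eta> r \<theta> t i)"
  unfolding bounded_solution_def
proof (intro conjI allI impI)
  define M where "M i = (\<Sum>\<^sub>\<infinity>js. norm (path_weight \<eta> r i js))" for i
  have M: "norm (path_sum \<eta> r \<theta> t i) \<le> M i" for t i
    using norm_infsum_bound[of "\<lambda>js. path_weight \<eta> r i js * character (path_pattern t i js) \<theta>" UNIV]
      path_weight_abs_summable[OF assms]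
    by (simp add: path_sum_def M_def norm_mult)
  have "norm (\<chi> i. path_sum \<eta> r \<theta> t i) \<le> (\<Sum>i\<in>UNIV. M i)" for t
  proof -
    have "norm (\<chi> i. path_sum \<eta> r \<theta> t i) \<le> (\<Sum>i\<in>UNIV. norm (path_sum \<eta> r \<theta> t i))"
      using norm_le_l1_cart[of "\<chi> i. norm (path_sum \<eta> r \<theta> t i)"]
      by (simp add: norm_vec_def)
    also have "\<dots> \<le> (\<Sum>i\<in>UNIV. M i)"
      by (intro sum_mono M)
    finally show ?thesis .
  qed
  then show "bounded ((\<lambda>t. \<chi> i. path_sum \<eta> r \<theta> t i) ` {..0})"
    unfolding bounded_iff by blast
  fix t :: int
  show "(\<chi> i. path_sum \<eta> r \<theta> t i) =
      transfer \<eta> r (\<theta> t) *v (\<chi> i. path_sum \<eta> r \<theta> (t - 1) i) + b_vac \<eta>"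
    using path_sum_recursion[OF assms, of \<theta> t]
    by (simp add: vec_eq_iff matrix_vector_mult_def)
qed

text \<open>The link to combinatorics: a nonzero coefficient requires a path of nonzero weight with
  pattern \<open>n\<close>.\<close>

lemma fourier_coeff_moment:
  assumes "0 < \<eta>" "\<eta> < 1" "r > 0" "\<eta> * exp (2 * r) < 1" "t \<le> 0" "n \<in> patterns"
  shows "fourier_coeff (moment \<eta> r t) n = (\<Sum>\<^sub>\<infinity>js\<in>path_pattern t 1 -` {n}. path_weight \<eta> r 1 js)"
proof (rule fourier_coeff_eqI[OF fourier_expansion_group assms(6)])
  show "(\<lambda>js. norm (path_weight \<eta> r 1 js)) summable_on UNIV"
    by (rule path_weight_abs_summable[OF assms(1-4)])
  show "path_pattern t 1 js \<in> patterns" for js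
    by (rule path_pattern_in_patterns[OF assms(5)])
  show "moment \<eta> r t \<theta> = (\<Sum>\<^sub>\<infinity>js. path_weight \<eta> r 1 js * character (path_pattern t 1 js) \<theta>)" for \<theta>
    using state_eqI[OF _ _ assms(4) bounded_solution_path_sum[OF assms(1-4)] assms(5)] assms(1,3)
    by (simp add: moment_def path_sum_def)
qed

section \<open>Selection rules\<close>

text \<open>The charge differences telescope, and nonzero weight forces the path to end in component
  3, whose charge is 0.\<close>

lemma charge_path_pattern:
  "path_weight \<eta> r i js \<noteq> 0 \<Longrightarrow> charge (path_pattern t i js) = component_charge i"
proof (induction js arbitrary: t i)
  case Nil
  then show ?case
    by (simp add: b_vac_nth charge_def component_charge_def split: if_splits)
next
  case (Cons j js)
  have "charge (path_pattern t i (j # js)) =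
      component_charge i - component_charge j + charge (path_pattern (t - 1) j js)"
    unfolding path_pattern.simps
    by (intro charge_fun_upd finite_support_path_pattern path_pattern_after) simp
  then show ?case
    using Cons by (simp del: path_pattern.simps)
qed

text \<open>Charges lie between -1 and 1, and each slot receives at most one difference of two
  charges.\<close>

lemma abs_path_pattern_le: "\<bar>path_pattern t i js s\<bar> \<le> 2"
  by (induction js arbitrary: t i) (auto simp: component_charge_def)

text \<open>A path of nonzero weight must leave component 1, because it ends in component 3. Until
  then it writes only 0, so the first step out fills the latest nonzero slot.\<close>

lemma path_pattern_leading:
  "path_weight \<eta> r 1 js \<noteq> 0 \<Longrightarrow>
     support (path_pattern t 1 js) \<noteq> {} \<and>
     path_pattern t 1 js (Max (support (path_pattern t 1 js))) \<in> {1, 2}"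
proof (induction js arbitrary: t)
  case Nil
  then show ?case by (simp add: b_vac_nth)
next
  case (Cons j js)
  show ?case
  proof (cases "j = 1")
    case True
    \<comment> \<open>A step from 1 to 1 writes 0 at \<open>t\<close>, where the shorter pattern is
      0 anyway.\<close>
    then have "path_pattern t 1 (j # js) = path_pattern (t - 1) 1 js"
      using path_pattern_after[of "t - 1" t 1 js] by (auto simp: fun_eq_iff)
    then show ?thesis
      using Cons True by (simp del: path_pattern.simps)
  next
    case False
    \<comment> \<open>Leaving to component 3 writes \<open>1 - 0\<close>, leaving to component 2
      writes \<open>1 - (- 1)\<close>.\<close>
    then have t: "path_pattern t 1 (j # js) t \<in> {1, 2}"
      using exhaust_3[of j] by (auto simp: component_charge_def)
    then have "t \<in> support (path_pattern t 1 (j # js))"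
      by (auto simp: support_def)
    moreover from this have "Max (support (path_pattern t 1 (j # js))) = t"
      using support_path_pattern[of t 1 "j # js"] finite_support_path_pattern[of t 1 "j # js"]
      by (intro Max_eqI) auto
    ultimately show ?thesis
      using t by (metis empty_iff)
  qed
qed

theorem corollary1:
  fixes \<eta> r :: real and t :: int and n :: "int \<Rightarrow> int"
  assumes "0 < \<eta>" "\<eta> < 1" "r > 0" "\<eta> * exp (2 * r) < 1"
    and "t \<le> 0"
    and "n \<in> patterns"
    and "fourier_coeff (moment \<eta> r t) n \<noteq> 0"
  shows "charge n = 1 \<and>
         support n \<noteq> {} \<and> n (Max (support n)) \<in> {1, 2} \<and>
         (\<forall>s. \<bar>n s\<bar> \<le> 2)"
proof -
  \<comment> \<open>If all paths with pattern \<open>n\<close> had weight 0, the sum giving the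
    coefficient would vanish.\<close>
  from assms(7) obtain js where js: "n = path_pattern t 1 js" "path_weight \<eta> r 1 js \<noteq> 0"
    unfolding fourier_coeff_moment[OF assms(1-6)] using infsum_0 by (metis vimage_singleton_eq)
  have "charge n = 1"
    using charge_path_pattern[OF js(2), of t] by (simp add: js(1) component_charge_def)
  moreover have "support n \<noteq> {} \<and> n (Max (support n)) \<in> {1, 2}"
    unfolding js(1) by (rule path_pattern_leading[OF js(2)])
  moreover have "\<bar>n s\<bar> \<le> 2" for s
    unfolding js(1) by (rule abs_path_pattern_le)
  ultimately show ?thesis
    by blast
qed

end
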